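(* Let $m=2$, let $n$ be a positive integer and let $1\le i\le n-2$. Then for every $k$ with $n-i+1\le k\le n$ one has $$|\mathcal{W}_i\cap\mathcal{B}_k| = p_{2,\,k+2+i-n},$$ and therefore the free $\mathbb{Z}_2$-module $\mathfrak{N}_i/\mathfrak{N}_{i-1}$ has rank $q_{2,\,i+2}$.
   Context: A partition is a finitely supported sequence $\Lambda=(\lambda_i)_{i\ge1}$ of non-negative integers ($\lambda_i$ is the multiplicity of the part $i$); its weight is $\mathrm{wt}(\Lambda)=\sum_i i\lambda_i$ and its number of parts is $\sum_i\lambda_i$ (parts counted with multiplicity). For $j\ge 0$, $\mathcal{P}_2(j)$ is the set of partitions with all parts at most $j$ and all multiplicities at most $1$ (it contains the empty partition). Write $x^\Lambda=\prod_i x_i^{\lambda_i}$, regarded in the ring $\mathcal{O}_2(n)=\mathbb{Z}_2[x_1,\dots,x_n]/(x_1^2,\dots,x_n^2)$, on which the partial derivatives $\partial_k$ act as derivations. The Lie ring of partitions $\mathfrak{L}=\mathfrak{L}(n)$ is the free $\mathbb{Z}_2$-module with basis $\mathcal{B}=\bigcup_{k=1}^n\mathcal{B}_k$, $\mathcal{B}_k=\{x^\Lambda\partial_k \mid \Lambda\in\mathcal{P}_2(k-1)\}$, and Lie bracket determined bilinearly by $[x^\Lambda\partial_k,x^\Theta\partial_j]=\partial_j(x^\Lambda)x^\Theta\partial_k-x^\Lambda\partial_k(x^\Theta)\partial_j$. The idealizer of a subring $\mathfrak{H}$ of $\mathfrak{L}$ is $N_{\mathfrak{L}}(\mathfrak{H})=\{z\in\mathfrak{L}\mid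 [z,h]\in\mathfrak{H}\ \forall h\in\mathfrak{H}\}$. Let $\mathfrak{T}$ be the $\mathbb{Z}_2$-span of $\partial_1,\dots,\partial_n$. The idealizer chain is $\mathfrak{N}_0=N_{\mathfrak{L}}(\mathfrak{T})$ and $\mathfrak{N}_i=N_{\mathfrak{L}}(\mathfrak{N}_{i-1})$ for $i\ge1$. For $1\le i\le n-2$, $\mathcal{W}_i$ is the set of all $x^\Lambda\partial_k\in\mathcal{B}$ such that $\Lambda$ has at least two parts, $n-i+1\le k\le n$ and $\mathrm{wt}(\Lambda)=k+i-n+2$. $p_{2,i}$ denotes the number of partitions of $i$ into at least two parts, all distinct, and $q_{2,i}=\sum_{j=1}^i p_{2,j}$. *)

theory Defs
  imports "HOL-Library.Poly_Mapping" "HOL-Library.Z2" "HOL-Algebra.AbelCoset"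
    "Jordan_Normal_Form.VS_Connect"
begin

section \<open>Partitions\<close>

text \<open>
  A partition is a finitely supported sequence of multiplicities \<open>\<lambda>\<^sub>i\<close>, \<open>i \<ge> 1\<close>. The type
  \<open>nat \<Rightarrow>\<^sub>0 nat\<close> also has a slot for the index 0, which has to vanish.
\<close>

type_synonym multiplicities = "nat \<Rightarrow>\<^sub>0 nat"

definition is_partition :: "multiplicities \<Rightarrow> bool" where
  "is_partition L \<longleftrightarrow> Poly_Mapping.lookup L 0 = 0"

definition wt :: "multiplicities \<Rightarrow> nat" where
  "wt L = (\<Sum>i\<in>Poly_Mapping.keys L. i * Poly_Mapping.lookup L i)"

definition num_parts :: "multiplicities \<Rightarrow> nat" where
  "num_parts L = (\<Sum>i\<in>Poly_Mapping.keys L. Poly_Mapping.lookup L i)"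

definition parts2 :: "nat \<Rightarrow> multiplicities set" where
  "parts2 j = {L. is_partition L \<and> (\<forall>i\<in>Poly_Mapping.keys L. i \<le> j) \<and> (\<forall>i. Poly_Mapping.lookup L i \<le> 1)}"

definition p2 :: "nat \<Rightarrow> nat" where
  "p2 i = card {L. is_partition L \<and> (\<forall>j. Poly_Mapping.lookup L j \<le> 1) \<and> num_parts L \<ge> 2 \<and> wt L = i}"

definition q2 :: "nat \<Rightarrow> nat" where
  "q2 i = (\<Sum>j=1..i. p2 j)"


section \<open>The truncated polynomial ring\<close>

text \<open>
  Polynomials over \<open>\<int>\<^sub>2\<close> are the elements of the monoid algebra \<open>(nat \<Rightarrow>\<^sub>0 nat) \<Rightarrow>\<^sub>0 bit\<close>. A class
  modulo \<open>(x\<^sub>i\<^sup>2)\<close> is represented by its unique representative all of whose monomials are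
  square-free; \<open>trunc2\<close> computes this representative, see \<open>trunc2_eq_0_iff\<close> and \<open>trunc2_idem\<close>.
\<close>

type_synonym poly2 = "multiplicities \<Rightarrow>\<^sub>0 bit"

definition monomial :: "multiplicities \<Rightarrow> poly2" where
  "monomial L = Poly_Mapping.single L 1"

definition trunc2 :: "poly2 \<Rightarrow> poly2" where
  "trunc2 f = (\<Sum>L\<in>{L \<in> Poly_Mapping.keys f. \<forall>i. Poly_Mapping.lookup L i \<le> 1}. Poly_Mapping.single L (Poly_Mapping.lookup f L))"

definition partial_deriv :: "nat \<Rightarrow> poly2 \<Rightarrow> poly2" where
  "partial_deriv k f =
     (\<Sum>L\<in>Poly_Mapping.keys f. Poly_Mapping.single (L - Poly_Mapping.single k 1) (of_nat (Poly_Mapping.lookup L k) * Poly_Mapping.lookup f L))"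

definition sq_ideal :: "poly2 set" where
  "sq_ideal = Modules.module.span (*) {monomial (Poly_Mapping.single i 2) | i. True}"

lemma lookup_trunc2: "Poly_Mapping.lookup (trunc2 f) L = (if \<forall>i. Poly_Mapping.lookup L i \<le> 1 then Poly_Mapping.lookup f L else 0)"
proof -
  have fin: "finite {L \<in> Poly_Mapping.keys f. \<forall>i. Poly_Mapping.lookup L i \<le> 1}" by simp
  show ?thesis
    unfolding trunc2_def lookup_sum lookup_single when_def sum.delta[OF fin]
    by (simp del: bit_not_zero_iff add: in_keys_iff)
qed

lemma trunc2_idem: "trunc2 (trunc2 f) = trunc2 f"
  by (rule poly_mapping_eqI) (simp add: lookup_trunc2)

lemma trunc2_add: "trunc2 (f + g) = trunc2 f + trunc2 g"
  by (rule poly_mapping_eqI) (simp add: lookup_trunc2 lookup_add)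

lemma trunc2_diff: "trunc2 (f - g) = trunc2 f - trunc2 g"
  by (rule poly_mapping_eqI) (simp add: lookup_trunc2 lookup_minus)

lemma trunc2_sum: "trunc2 (sum f A) = (\<Sum>a\<in>A. trunc2 (f a))"
proof (rule poly_mapping_eqI)
  fix L show "Poly_Mapping.lookup (trunc2 (sum f A)) L = Poly_Mapping.lookup (\<Sum>a\<in>A. trunc2 (f a)) L"
    by (cases "\<forall>i. Poly_Mapping.lookup L i \<le> 1") 
      (simp_all only: lookup_trunc2 lookup_sum if_True if_False sum.neutral_const simp_thms)
qed

lemma poly2_decomp: "f = (\<Sum>L\<in>Poly_Mapping.keys f. Poly_Mapping.single L (Poly_Mapping.lookup f L))" for f :: poly2
  by (rule poly_mapping_eqI)
    (simp del: bit_not_zero_iff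
      add: lookup_sum lookup_single when_def sum.delta[OF finite_keys] in_keys_iff)

lemma trunc2_mult_square: "trunc2 (f * monomial (Poly_Mapping.single i 2)) = 0"
proof -
  have "trunc2 (Poly_Mapping.single L c * monomial (Poly_Mapping.single i 2)) = 0" for L c
    by (rule poly_mapping_eqI)
      (auto simp: lookup_trunc2 monomial_def mult_single lookup_single lookup_add when_def
        dest!: spec[of _ i])
  then show ?thesis
    by (subst poly2_decomp[of f]) (simp add: sum_distrib_right trunc2_sum)
qed

lemma module_poly2: "Modules.module ((*) :: poly2 \<Rightarrow> poly2 \<Rightarrow> poly2)"
  by unfold_locales (auto simp: algebra_simps)

lemma sq_ideal_sum: "(\<And>a. a \<in> A \<Longrightarrow> f a \<in> sq_ideal) \<Longrightarrow> sum f A \<in> sq_ideal"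
  unfolding sq_ideal_def by (rule Modules.module.span_sum[OF module_poly2])

lemma trunc2_eq_0_iff: "trunc2 f = 0 \<longleftrightarrow> f \<in> sq_ideal"
proof
  assume 0: "trunc2 f = 0"
  have "Poly_Mapping.single L (Poly_Mapping.lookup f L) \<in> sq_ideal" if L: "L \<in> Poly_Mapping.keys f" for L
  proof -
    have "Poly_Mapping.lookup (trunc2 f) L = 0" using 0 by simp
    then obtain i where i: "\<not> Poly_Mapping.lookup L i \<le> 1"
      using L by (auto simp: lookup_trunc2 in_keys_iff split: if_splits)
    have L': "L = (L - Poly_Mapping.single i 2) + Poly_Mapping.single i 2"
      by (rule poly_mapping_eqI) (use i in \<open>auto simp: lookup_add lookup_minus lookup_single when_def\<close>)
    have "Poly_Mapping.single L (Poly_Mapping.lookup f L)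
        = Poly_Mapping.single (L - Poly_Mapping.single i 2) (Poly_Mapping.lookup f L) * monomial (Poly_Mapping.single i 2)"
      unfolding monomial_def mult_single L'[symmetric] by simp
    then show ?thesis
      unfolding sq_ideal_def
      using Modules.module.span_scale[OF module_poly2 Modules.module.span_base[OF module_poly2]]
      by (metis (mono_tags, lifting) mem_Collect_eq)
  qed
  then show "f \<in> sq_ideal"
    by (subst poly2_decomp[of f]) (rule sq_ideal_sum)
next
  assume "f \<in> sq_ideal"
  then obtain t r where "t \<subseteq> {monomial (Poly_Mapping.single i 2) | i. True}" "f = (\<Sum>a\<in>t. r a * a)"
    unfolding sq_ideal_def Modules.module.span_explicit[OF module_poly2] by blast
  then show "trunc2 f = 0"
    by (auto simp: trunc2_sum trunc2_mult_square intro!: sum.neutral)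
qed


section \<open>The Lie ring of partitions\<close>

text \<open>
  The basis element \<open>x\<^sup>L \<partial>\<^sub>k\<close> is indexed by the pair \<open>(L, k)\<close>. All the Lie rings, for varying \<open>n\<close>,
  live in the free \<open>\<int>\<^sub>2\<close>-module on such pairs.
\<close>

type_synonym lie = "(multiplicities \<times> nat) \<Rightarrow>\<^sub>0 bit"

definition lie_scale :: "bit \<Rightarrow> lie \<Rightarrow> lie" where
  "lie_scale c a = Poly_Mapping.map ((*) c) a"

lemma lookup_lie_scale: "Poly_Mapping.lookup (lie_scale c a) s = c * Poly_Mapping.lookup a s"
  by (simp add: lie_scale_def Poly_Mapping.map.rep_eq when_def)

interpretation lie: vector_space lie_scale
  by unfold_locales
    (simp_all only: poly_mapping_eq_iff fun_eq_iff lookup_lie_scale lookup_add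
      distrib_left distrib_right mult.assoc mult_1_left simp_thms)

definition basis_elem :: "multiplicities \<Rightarrow> nat \<Rightarrow> lie" where
  "basis_elem L k = Poly_Mapping.single (L, k) 1"

definition basis_at :: "nat \<Rightarrow> lie set" where
  "basis_at k = {basis_elem L k | L. L \<in> parts2 (k - 1)}"

definition lie_basis :: "nat \<Rightarrow> lie set" where
  "lie_basis n = (\<Union>k\<in>{1..n}. basis_at k)"

definition lie_ring :: "nat \<Rightarrow> lie set" where
  "lie_ring n = lie.span (lie_basis n)"

text \<open>The element \<open>f \<partial>\<^sub>k\<close> for a square-free polynomial \<open>f\<close>.\<close>

definition poly_field :: "poly2 \<Rightarrow> nat \<Rightarrow> lie" where
  "poly_field f k = (\<Sum>L\<in>Poly_Mapping.keys f. lie_scale (Poly_Mapping.lookup f L) (basis_elem L k))"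

definition basis_bracket :: "multiplicities \<Rightarrow> nat \<Rightarrow> multiplicities \<Rightarrow> nat \<Rightarrow> lie" where
  "basis_bracket L k T j =
     poly_field (trunc2 (partial_deriv j (monomial L) * monomial T)) k
     - poly_field (trunc2 (monomial L * partial_deriv k (monomial T))) j"

definition bracket :: "lie \<Rightarrow> lie \<Rightarrow> lie" where
  "bracket a b =
     (\<Sum>(L, k)\<in>Poly_Mapping.keys a. \<Sum>(T, j)\<in>Poly_Mapping.keys b.
        lie_scale (Poly_Mapping.lookup a (L, k) * Poly_Mapping.lookup b (T, j)) (basis_bracket L k T j))"


section \<open>The idealizer chain\<close>

definition idealizer :: "nat \<Rightarrow> lie set \<Rightarrow> lie set" where
  "idealizer n H = {z \<in> lie_ring n. \<forall>h\<in>H. bracket z h \<in> H}"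

definition derivations_span :: "nat \<Rightarrow> lie set" where
  "derivations_span n = lie.span {basis_elem 0 k | k. k \<in> {1..n}}"

primrec idealizer_chain :: "nat \<Rightarrow> nat \<Rightarrow> lie set" where
  "idealizer_chain n 0 = idealizer n (derivations_span n)"
| "idealizer_chain n (Suc i) = idealizer n (idealizer_chain n i)"

definition W :: "nat \<Rightarrow> nat \<Rightarrow> lie set" where
  "W n i = {basis_elem L k | L k.
     basis_elem L k \<in> lie_basis n \<and> num_parts L \<ge> 2 \<and> n - i + 1 \<le> k \<and> k \<le> n \<and> wt L = k + i - n + 2}"


section \<open>Quotient modules\<close>

text \<open>
  A \<open>module\<close> record carries the fields \<open>mult\<close> and \<open>one\<close> of a ring, which the locale
  \<open>module\<close> does not use.
\<close>

definition quotient_module :: "('a, 'b) module \<Rightarrow> 'b set \<Rightarrow> ('a, 'b set) module" where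
  "quotient_module M V =
     \<lparr>carrier = a_rcosets\<^bsub>M\<^esub> V, mult = undefined, one = undefined,
      zero = V, add = set_add M,
      smult = (\<lambda>c C. \<Union>x\<in>C. V +>\<^bsub>M\<^esub> (c \<odot>\<^bsub>M\<^esub> x))\<rparr>"

definition lie_module :: "lie set \<Rightarrow> (bit, lie) module" where
  "lie_module U =
     \<lparr>carrier = U, mult = undefined, one = undefined, zero = 0, add = (+), smult = lie_scale\<rparr>"

text \<open>
  As \<open>\<int>\<^sub>2\<close> is a field, every module over it is free, and its rank is its dimension
  (\<open>vectorspace.dim\<close>, meaningful under \<open>vectorspace.fin_dim\<close>).
\<close>

definition chain_quotient :: "nat \<Rightarrow> nat \<Rightarrow> (bit, lie set) module" where
  "chain_quotient n i =
     quotient_module (lie_module (idealizer_chain n i)) (idealizer_chain n (i - 1))"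

end

theory Submission
  imports Defs
begin

text \<open>
  Give \<open>x\<^sup>L \<partial>\<^sub>k\<close> with at least two parts in \<open>L\<close> the level \<open>wt L - 2 + n - k \<ge> 1\<close>. Bracketing with
  \<open>\<partial>\<^sub>j\<close> or \<open>x\<^sub>t \<partial>\<^sub>j\<close> strictly lowers the level, and the bracket of levels \<open>a\<close> and \<open>b\<close> has level
  \<open>a + b + 2 - n\<close>. Hence, as long as \<open>i \<le> n - 2\<close>, the span of the monomials that have at most one
  part or level at most \<open>i\<close> idealizes the one for \<open>i - 1\<close>. Conversely, each monomial of level
  greater than \<open>i\<close> is sent outside the latter by a monomial that lowers its level by exactly one
  and keeps at least two parts: \<open>x\<^sub>t \<partial>\<^sub>t\<^sub>+\<^sub>1\<close> if \<open>L\<close> contains \<open>t + 1\<close> but not \<open>t\<close>, else \<open>\<partial>\<^sub>1\<close> if \<open>L\<close> has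
  three or more parts, else \<open>L\<close> has the parts 1 and 2 only and \<open>x\<^sub>k \<partial>\<^sub>k\<^sub>+\<^sub>1\<close> does it. These brackets do not cancel
  against those of the other monomials. So \<open>N\<^sub>i / N\<^sub>i\<^sub>-\<^sub>1\<close> has as a basis the monomials of level
  \<open>i\<close>, that is \<open>W\<^sub>i\<close>.
\<close>


section \<open>Square-free monomials\<close>

definition part :: "nat \<Rightarrow> multiplicities" where
  "part i = Poly_Mapping.single i 1"

abbreviation mult_of :: "multiplicities \<Rightarrow> nat \<Rightarrow> nat" where
  "mult_of \<equiv> Poly_Mapping.lookup"

lemma lookup_part: "mult_of (part i) j = (if i = j then 1 else 0)"
  by (simp add: part_def lookup_single when_def)

definition sqfree :: "multiplicities \<Rightarrow> bool" where
  "sqfree L \<longleftrightarrow> (\<forall>i. mult_of L i \<le> 1)"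

lemma wt_eq_sum: "finite S \<Longrightarrow> Poly_Mapping.keys L \<subseteq> S \<Longrightarrow> wt L = (\<Sum>i\<in>S. i * mult_of L i)"
  unfolding wt_def by (rule sum.mono_neutral_left) (auto simp: in_keys_iff)

lemma num_parts_eq_sum: "finite S \<Longrightarrow> Poly_Mapping.keys L \<subseteq> S \<Longrightarrow> num_parts L = (\<Sum>i\<in>S. mult_of L i)"
  unfolding num_parts_def by (rule sum.mono_neutral_left) (auto simp: in_keys_iff)

lemma wt_add [simp]: "wt (L + T) = wt L + wt T"
proof -
  let ?S = "Poly_Mapping.keys L \<union> Poly_Mapping.keys T"
  have "Poly_Mapping.keys (L + T) \<subseteq> ?S" by (rule keys_add)
  then show ?thesis
    by (simp add: wt_eq_sum[of ?S] lookup_add distrib_left sum.distrib)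
qed

lemma num_parts_add [simp]: "num_parts (L + T) = num_parts L + num_parts T"
proof -
  let ?S = "Poly_Mapping.keys L \<union> Poly_Mapping.keys T"
  have "Poly_Mapping.keys (L + T) \<subseteq> ?S" by (rule keys_add)
  then show ?thesis
    by (simp add: num_parts_eq_sum[of ?S] lookup_add sum.distrib)
qed

lemma wt_part [simp]: "wt (part i) = i"
  by (simp add: wt_def part_def)

lemma num_parts_part [simp]: "num_parts (part i) = 1"
  by (simp add: num_parts_def part_def)

lemma wt_zero [simp]: "wt 0 = 0"
  by (simp add: wt_def)

lemma num_parts_zero_iff [simp]: "num_parts L = 0 \<longleftrightarrow> L = 0"
proof
  assume "num_parts L = 0"
  then have "mult_of L i = 0" for i
    by (cases "i \<in> Poly_Mapping.keys L") (auto simp: num_parts_def in_keys_iff)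
  then show "L = 0" by (intro poly_mapping_eqI) simp
qed (simp add: num_parts_def)

lemma num_parts_zero [simp]: "num_parts 0 = 0"
  by simp

section \<open>Removing one part from a partition\<close>

lemma minus_part_add: "mult_of L i \<noteq> 0 \<Longrightarrow> L - part i + part i = L"
  by (rule poly_mapping_eqI) (auto simp: lookup_add lookup_minus lookup_part)

lemma wt_minus_part: "mult_of L i \<noteq> 0 \<Longrightarrow> wt (L - part i) + i = wt L"
  by (metis minus_part_add wt_add wt_part)

lemma num_parts_minus_part: "mult_of L i \<noteq> 0 \<Longrightarrow> num_parts (L - part i) + 1 = num_parts L"
  by (metis minus_part_add num_parts_add num_parts_part)

lemma parts2_iff: "L \<in> parts2 j \<longleftrightarrow> sqfree L \<and> (\<forall>i. mult_of L i \<noteq> 0 \<longrightarrow> 1 \<le> i \<and> i \<le> j)"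
  by (auto simp: parts2_def sqfree_def is_partition_def in_keys_iff Suc_le_eq intro: gr0I)

lemma zero_in_parts2 [simp]: "0 \<in> parts2 j"
  by (simp add: parts2_iff sqfree_def)

lemma part_in_parts2 [simp]: "part i \<in> parts2 j \<longleftrightarrow> 1 \<le> i \<and> i \<le> j"
  by (auto simp: parts2_iff sqfree_def lookup_part)

lemma exists_part: "L \<noteq> 0 \<Longrightarrow> \<exists>i. mult_of L i \<noteq> 0"
  by (metis lookup_zero poly_mapping_eqI)

lemma wt_single_part:
  assumes "num_parts L = 1" "mult_of L i \<noteq> 0"
  shows "L = part i" "wt L = i"
proof -
  have "L - part i = 0"
    using num_parts_minus_part[OF assms(2)] assms(1) by simp
  then show "L = part i" using minus_part_add[OF assms(2)] by simp
  then show "wt L = i" by simp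
qed

lemma wt_le_of_num_parts_le_1:
  assumes "num_parts L \<le> 1" "L \<in> parts2 j"
  shows "wt L \<le> j"
proof (cases "L = 0")
  case False
  then obtain i where "mult_of L i \<noteq> 0" using exists_part by blast
  moreover have "num_parts L = 1" using assms(1) False by (simp add: le_Suc_eq)
  ultimately show ?thesis using wt_single_part[of L i] assms(2) by (auto simp: parts2_iff)
qed simp

section \<open>Lower bounds for the weight\<close>

lemma wt_pos: "is_partition L \<Longrightarrow> L \<noteq> 0 \<Longrightarrow> 1 \<le> wt L"
  by (metis One_nat_def Suc_le_eq add_is_0 exists_part gr0I is_partition_def wt_minus_part)

lemma is_partition_minus: "is_partition L \<Longrightarrow> is_partition (L - T)"
  by (simp add: is_partition_def lookup_minus)

text \<open>Removing the part \<open>i\<close> leaves a nonempty partition, whose weight is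
  positive.\<close>

lemma part_less_wt:
  assumes "is_partition L" "2 \<le> num_parts L" "mult_of L i \<noteq> 0"
  shows "i < wt L"
proof -
  have "num_parts (L - part i) \<noteq> 0" using num_parts_minus_part[OF assms(3)] assms(2) by linarith
  then have "L - part i \<noteq> 0" by simp
  then have "1 \<le> wt (L - part i)" using wt_pos is_partition_minus assms(1) by blast
  then show ?thesis using wt_minus_part[OF assms(3)] by simp
qed

lemma sqfree_mult_of: "sqfree L \<Longrightarrow> mult_of L i \<noteq> 0 \<Longrightarrow> mult_of L i = 1"
  unfolding sqfree_def by (metis One_nat_def le_Suc_eq le_zero_eq)

text \<open>Square-freeness allows a single part equal to 1, so another part is at least 2.\<close>

lemma exists_part_ge_2:
  assumes "L \<in> parts2 j" "2 \<le> num_parts L"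
  shows "\<exists>i\<ge>2. mult_of L i \<noteq> 0"
proof (rule ccontr)
  assume "\<not> ?thesis"
  then have "i = 1" if "mult_of L i \<noteq> 0" for i
    using assms(1) that unfolding parts2_iff by (metis Suc_1 le_antisym not_less_eq_eq One_nat_def)
  then have "Poly_Mapping.keys L \<subseteq> {1}" by (metis (no_types) in_keys_iff singleton_iff subsetI)
  then have "num_parts L = sum (mult_of L) {1}" by (intro num_parts_eq_sum) simp
  moreover have "mult_of L 1 \<le> 1" using assms(1) by (simp add: parts2_iff sqfree_def)
  ultimately show False using assms(2) by simp
qed

text \<open>A part that is at least 2 is strictly below the weight. This bound is what makes every
  level positive.\<close>

lemma wt_ge_3:
  assumes "L \<in> parts2 j" "2 \<le> num_parts L"
  shows "3 \<le> wt L"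
proof -
  obtain i where "2 \<le> i" "mult_of L i \<noteq> 0" using exists_part_ge_2 assms by blast
  moreover have "is_partition L" using assms(1) by (simp add: parts2_def)
  ultimately show ?thesis using part_less_wt[of L i] assms(2) by simp
qed

text \<open>A square-free partition is determined by its set of parts, here a subset of
  \<open>{..j}\<close>.\<close>

lemma finite_parts2: "finite (parts2 j)"
proof (rule finite_imageD)
  show "finite (Poly_Mapping.keys ` parts2 j)"
    by (rule finite_subset[of _ "Pow {..j}"]) (auto simp: parts2_def)
  show "inj_on Poly_Mapping.keys (parts2 j)"
  proof (intro inj_onI poly_mapping_eqI)
    fix L T i
    assume "L \<in> parts2 j" "T \<in> parts2 j" "Poly_Mapping.keys L = Poly_Mapping.keys T"
    moreover from this have "mult_of L i \<noteq> 0 \<longleftrightarrow> mult_of T i \<noteq> 0"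
      unfolding in_keys_iff[symmetric] by simp
    ultimately show "mult_of L i = mult_of T i"
      unfolding parts2_iff by (metis sqfree_mult_of)
  qed
qed

text \<open>Every term of a bracket has this form: the part \<open>j\<close> is traded for the parts
  of \<open>T\<close>, all below \<open>j\<close> and so within the bound \<open>m\<close>.\<close>

lemma replace_part_in_parts2:
  assumes L: "L \<in> parts2 m" and T: "T \<in> parts2 (j - 1)" and "j \<le> m + 1" "sqfree (L - part j + T)"
  shows "L - part j + T \<in> parts2 m"
proof -
  have "1 \<le> i \<and> i \<le> m" if "mult_of (L - part j + T) i \<noteq> 0" for i
  proof -
    have "mult_of L i \<noteq> 0 \<or> mult_of T i \<noteq> 0"
      using that by (simp add: lookup_add lookup_minus del: neq0_conv)
    then have "1 \<le> i \<and> (i \<le> m \<or> i \<le> j - 1)"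
      using L T unfolding parts2_iff by blast
    then show ?thesis using \<open>j \<le> m + 1\<close> by linarith
  qed
  then show ?thesis using assms(4) by (simp add: parts2_iff)
qed


section \<open>The bracket on monomials\<close>

lemma trunc2_single: "trunc2 (Poly_Mapping.single L c) = (if sqfree L then Poly_Mapping.single L c else 0)"
  by (rule poly_mapping_eqI) (auto simp: lookup_trunc2 sqfree_def lookup_single when_def)

lemma partial_deriv_monomial:
  "partial_deriv j (monomial L) = Poly_Mapping.single (L - part j) (of_nat (mult_of L j))"
  by (simp add: partial_deriv_def monomial_def part_def)

lemma trunc2_zero [simp]: "trunc2 0 = 0"
  by (simp add: trunc2_def)

lemma poly_field_zero [simp]: "poly_field 0 k = 0"
  by (simp add: poly_field_def)

lemma lie_scale_one [simp]: "lie_scale 1 a = a"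
  by (rule poly_mapping_eqI) (simp add: lookup_lie_scale)

lemma poly_field_monomial: "poly_field (Poly_Mapping.single L 1) k = basis_elem L k"
  by (simp add: poly_field_def)

text \<open>Multiplicities are 0 or 1, so a derivative of a square-free monomial is a single
  monomial or 0. Each half of the bracket is therefore one basis element, or 0 because the part is
  missing or the product is not square-free.\<close>

lemma basis_bracket_eq:
  assumes "sqfree L" "sqfree T"
  shows "basis_bracket L k T j =
    (if mult_of L j \<noteq> 0 \<and> sqfree (L - part j + T) then basis_elem (L - part j + T) k else 0)
    - (if mult_of T k \<noteq> 0 \<and> sqfree (L + (T - part k)) then basis_elem (L + (T - part k)) j else 0)"
proof -
  have "poly_field (trunc2 (partial_deriv j (monomial L) * monomial T)) k
      = (if mult_of L j \<noteq> 0 \<and> sqfree (L - part j + T) then basis_elem (L - part j + T) k else 0)"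
    using sqfree_mult_of[OF assms(1), of j]
    by (cases "mult_of L j = 0")
      (simp_all add: partial_deriv_monomial monomial_def[of T] mult_single trunc2_single poly_field_monomial)
  moreover have "poly_field (trunc2 (monomial L * partial_deriv k (monomial T))) j
      = (if mult_of T k \<noteq> 0 \<and> sqfree (L + (T - part k)) then basis_elem (L + (T - part k)) j else 0)"
    using sqfree_mult_of[OF assms(2), of k]
    by (cases "mult_of T k = 0")
      (simp_all add: partial_deriv_monomial monomial_def[of L] mult_single trunc2_single poly_field_monomial)
  ultimately show ?thesis by (simp only: basis_bracket_def)
qed

lemma in_keys_basis_bracket:
  assumes "sqfree L" "sqfree T" "(S, l) \<in> Poly_Mapping.keys (basis_bracket L k T j)"
  shows "mult_of L j \<noteq> 0 \<and> sqfree S \<and> S = L - part j + T \<and> l = k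
    \<or> mult_of T k \<noteq> 0 \<and> sqfree S \<and> S = L + (T - part k) \<and> l = j"
proof -
  let ?A = "if mult_of L j \<noteq> 0 \<and> sqfree (L - part j + T) then basis_elem (L - part j + T) k else 0"
  let ?B = "if mult_of T k \<noteq> 0 \<and> sqfree (L + (T - part k)) then basis_elem (L + (T - part k)) j else 0"
  have "(S, l) \<in> Poly_Mapping.keys ?A \<union> Poly_Mapping.keys ?B"
    using assms(3) keys_diff[of ?A ?B] unfolding basis_bracket_eq[OF assms(1,2)] by blast
  then show ?thesis
    unfolding Un_iff
  proof (elim disjE)
    assume "(S, l) \<in> Poly_Mapping.keys ?A"
    then show ?thesis by (auto simp: basis_elem_def split: if_splits)
  next
    assume "(S, l) \<in> Poly_Mapping.keys ?B"
    then show ?thesis by (auto simp: basis_elem_def split: if_splits)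
  qed
qed

section \<open>Supports of brackets\<close>

lemma in_keys_sumE:
  assumes "s \<in> Poly_Mapping.keys (sum f A)"
  obtains a where "a \<in> A" "s \<in> Poly_Mapping.keys (f a)"
  using subsetD[OF keys_sum assms] by blast

lemma in_keys_bracket:
  assumes "s \<in> Poly_Mapping.keys (bracket a b)"
  obtains L k T j where "(L, k) \<in> Poly_Mapping.keys a" "(T, j) \<in> Poly_Mapping.keys b"
    "s \<in> Poly_Mapping.keys (basis_bracket L k T j)"
proof -
  have "bracket a b = (\<Sum>p\<in>Poly_Mapping.keys a. \<Sum>q\<in>Poly_Mapping.keys b.
      lie_scale (Poly_Mapping.lookup a p * Poly_Mapping.lookup b q)
        (basis_bracket (fst p) (snd p) (fst q) (snd q)))"
    by (simp add: bracket_def split_def)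
  with assms obtain p q where p: "p \<in> Poly_Mapping.keys a" and q: "q \<in> Poly_Mapping.keys b"
    and "s \<in> Poly_Mapping.keys (lie_scale (Poly_Mapping.lookup a p * Poly_Mapping.lookup b q)
        (basis_bracket (fst p) (snd p) (fst q) (snd q)))"
    by (auto elim!: in_keys_sumE)
  then have "s \<in> Poly_Mapping.keys (basis_bracket (fst p) (snd p) (fst q) (snd q))"
    by (simp add: in_keys_iff lookup_lie_scale)
  then show thesis using that[of "fst p" "snd p" "fst q" "snd q"] p q by simp
qed

lemma bracket_basis_elem:
  "bracket z (basis_elem T j) =
    (\<Sum>p\<in>Poly_Mapping.keys z. lie_scale (Poly_Mapping.lookup z p) (basis_bracket (fst p) (snd p) T j))"
proof -
  have "Poly_Mapping.keys (basis_elem T j) = {(T, j)}" "Poly_Mapping.lookup (basis_elem T j) (T, j) = 1"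
    by (simp_all add: basis_elem_def)
  then show ?thesis
    by (simp only: bracket_def split_def sum.insert sum.empty finite.emptyI empty_iff not_False_eq_True
      fst_conv snd_conv mult_1_right prod.collapse add_0_right)
qed

text \<open>Only one summand contributes at \<open>s\<close>, so nothing cancels, and its
  coefficient is a product of two nonzero scalars.\<close>

lemma in_keys_bracket_basis_elem:
  assumes "(L, k) \<in> Poly_Mapping.keys z" "s \<in> Poly_Mapping.keys (basis_bracket L k T j)"
    and uniq: "\<And>L' k'. (L', k') \<in> Poly_Mapping.keys z \<Longrightarrow>
      s \<in> Poly_Mapping.keys (basis_bracket L' k' T j) \<Longrightarrow> (L', k') = (L, k)"
  shows "s \<in> Poly_Mapping.keys (bracket z (basis_elem T j))"
proof -
  let ?f = "\<lambda>p. Poly_Mapping.lookup z p * Poly_Mapping.lookup (basis_bracket (fst p) (snd p) T j) s"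
  have "Poly_Mapping.lookup (bracket z (basis_elem T j)) s = (\<Sum>p\<in>Poly_Mapping.keys z. ?f p)"
    by (simp only: bracket_basis_elem lookup_sum lookup_lie_scale)
  also have "\<dots> = (\<Sum>p\<in>{(L, k)}. ?f p)"
  proof (rule sum.mono_neutral_right)
    show "\<forall>p\<in>Poly_Mapping.keys z - {(L, k)}. ?f p = 0"
      using uniq by (metis Diff_iff in_keys_iff mult_zero_right prod.collapse singletonI)
  qed (use assms(1) in auto)
  also have "\<dots> = ?f (L, k)" by simp
  also have "\<dots> \<noteq> 0"
    using assms(1,2) unfolding in_keys_iff by (simp only: mult_eq_0_iff fst_conv snd_conv simp_thms)
  finally show ?thesis unfolding in_keys_iff .
qed


section \<open>The idealizer chain\<close>

definition index_set :: "nat \<Rightarrow> (multiplicities \<times> nat) set" where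
  "index_set n = {(L, k). k \<in> {1..n} \<and> L \<in> parts2 (k - 1)}"

lemma index_set_part:
  assumes "(L, k) \<in> index_set n" "mult_of L j \<noteq> 0"
  shows "1 \<le> j" "j < k" "k \<le> n"
proof -
  have "1 \<le> k" "k \<le> n" "L \<in> parts2 (k - 1)" using assms(1) by (auto simp: index_set_def)
  moreover from this have "1 \<le> j \<and> j \<le> k - 1" using assms(2) unfolding parts2_iff by blast
  ultimately show "1 \<le> j" "j < k" "k \<le> n" by linarith+
qed

text \<open>The condition on the weight says that the level \<open>wt L - 2 + n - k\<close> is at most \<open>i\<close>.\<close>

definition layer :: "nat \<Rightarrow> nat \<Rightarrow> (multiplicities \<times> nat) set" where
  "layer n i = {(L, k) \<in> index_set n. num_parts L \<le> 1 \<or> wt L + n \<le> i + 2 + k}"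

text \<open>The terms of the chain computed below are coordinate subspaces of this kind, which turns
  each idealizer into a question about index sets.\<close>

definition supported_on :: "(multiplicities \<times> nat) set \<Rightarrow> lie set" where
  "supported_on P = {z. Poly_Mapping.keys z \<subseteq> P}"

text \<open>The only nonzero element of \<open>bit\<close> is 1, so \<open>z\<close> is the plain
  sum of the basis elements in its support.\<close>

lemma span_basis_elem: "lie.span {basis_elem L k | L k. (L, k) \<in> P} = supported_on P"
proof (rule lie.span_unique)
  show "{basis_elem L k | L k. (L, k) \<in> P} \<subseteq> supported_on P"
    by (auto simp: supported_on_def basis_elem_def)
  show "lie.subspace (supported_on P)"
    by (rule lie.subspaceI)
      (auto simp: supported_on_def in_keys_iff lookup_lie_scale dest: keys_add[THEN subsetD])
  fix V assume V: "{basis_elem L k | L k. (L, k) \<in> P} \<subseteq> V" "lie.subspace V"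
  show "supported_on P \<subseteq> V"
  proof
    fix z assume z: "z \<in> supported_on P"
    have "z = (\<Sum>p\<in>Poly_Mapping.keys z. basis_elem (fst p) (snd p))"
    proof (rule poly_mapping_eqI)
      fix s
      have "Poly_Mapping.lookup (\<Sum>p\<in>Poly_Mapping.keys z. basis_elem (fst p) (snd p)) s
          = (\<Sum>p\<in>Poly_Mapping.keys z. if s = p then 1 else 0)"
        unfolding lookup_sum by (rule sum.cong) (auto simp: basis_elem_def lookup_single when_def)
      also have "\<dots> = (if s \<in> Poly_Mapping.keys z then 1 else 0)"
        by (simp only: sum.delta' finite_keys)
      also have "\<dots> = Poly_Mapping.lookup z s"
        by (simp add: in_keys_iff)
      finally show "Poly_Mapping.lookup z s
          = Poly_Mapping.lookup (\<Sum>p\<in>Poly_Mapping.keys z. basis_elem (fst p) (snd p)) s" ..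
    qed
    also have "\<dots> \<in> V"
    proof (rule lie.subspace_sum[OF V(2)])
      fix p assume "p \<in> Poly_Mapping.keys z"
      then have "p \<in> P" using z by (auto simp: supported_on_def)
      then show "basis_elem (fst p) (snd p) \<in> V" using V(1) by (cases p) auto
    qed
    finally show "z \<in> V" .
  qed
qed

lemma basis_elem_in_supported_on [simp]: "basis_elem L k \<in> supported_on P \<longleftrightarrow> (L, k) \<in> P"
  by (simp add: supported_on_def basis_elem_def)

lemma basis_elem_eq_iff [simp]: "basis_elem L k = basis_elem T j \<longleftrightarrow> L = T \<and> k = j"
  unfolding basis_elem_def by (auto dest!: arg_cong[of _ _ Poly_Mapping.keys])

lemma in_lie_basis_iff: "basis_elem L k \<in> lie_basis n \<longleftrightarrow> (L, k) \<in> index_set n"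
  by (auto simp: lie_basis_def basis_at_def index_set_def)

lemma lie_ring_eq: "lie_ring n = supported_on (index_set n)"
proof -
  have "lie_basis n = {basis_elem L k | L k. (L, k) \<in> index_set n}"
    by (auto simp: lie_basis_def basis_at_def index_set_def)
  then show ?thesis by (simp only: lie_ring_def span_basis_elem)
qed

lemma derivations_span_eq: "derivations_span n = supported_on {(0, k) | k. k \<in> {1..n}}"
proof -
  have "{basis_elem 0 k | k. k \<in> {1..n}} = {basis_elem L k | L k. (L, k) \<in> {(0, k) | k. k \<in> {1..n}}}"
    by auto
  then show ?thesis by (simp only: derivations_span_def span_basis_elem)
qed

text \<open>The coefficient of \<open>[z, x\<^sup>T \<partial>\<^sub>j]\<close> at \<open>s\<close> only involves the coefficient of \<open>z\<close> at \<open>(L, k)\<close>.\<close>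

definition isolating :: "nat \<Rightarrow> multiplicities \<Rightarrow> nat \<Rightarrow> multiplicities \<Rightarrow> nat \<Rightarrow> multiplicities \<times> nat \<Rightarrow> bool" where
  "isolating n L k T j s \<longleftrightarrow> s \<in> Poly_Mapping.keys (basis_bracket L k T j) \<and>
    (\<forall>L' k'. (L', k') \<in> index_set n \<longrightarrow> s \<in> Poly_Mapping.keys (basis_bracket L' k' T j)
      \<longrightarrow> (L', k') = (L, k))"

text \<open>By bilinearity, \<open>closed\<close> puts the span of \<open>Q\<close> into the
  idealizer. Conversely, if an idealizing \<open>z\<close> had a term outside \<open>Q\<close>, its
  witness would give a bracket of \<open>z\<close> with an element of the span of \<open>P\<close>
  whose coefficient at \<open>s\<close> survives, although \<open>s\<close> is not in
  \<open>P\<close>.\<close>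

lemma idealizer_supported_on_eqI:
  assumes "Q \<subseteq> index_set n"
    and closed: "\<And>L k T j s. (L, k) \<in> Q \<Longrightarrow> (T, j) \<in> P \<Longrightarrow>
      s \<in> Poly_Mapping.keys (basis_bracket L k T j) \<Longrightarrow> s \<in> P"
    and witness: "\<And>L k. (L, k) \<in> index_set n - Q \<Longrightarrow> \<exists>T j s. (T, j) \<in> P \<and> s \<notin> P \<and>
      isolating n L k T j s"
  shows "idealizer n (supported_on P) = supported_on Q"
proof (intro equalityI subsetI)
  fix z assume z: "z \<in> idealizer n (supported_on P)"
  then have z_index: "Poly_Mapping.keys z \<subseteq> index_set n"
    by (simp add: idealizer_def lie_ring_eq supported_on_def)
  show "z \<in> supported_on Q"
    unfolding supported_on_def
  proof (intro CollectI subsetI, rule ccontr)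
    fix p assume p: "p \<in> Poly_Mapping.keys z" "p \<notin> Q"
    obtain L k where p_eq: "p = (L, k)" by (cases p)
    then obtain T j s where Tj: "(T, j) \<in> P" and s: "s \<notin> P"
      and "s \<in> Poly_Mapping.keys (basis_bracket L k T j)"
      and "\<And>L' k'. (L', k') \<in> index_set n \<Longrightarrow> s \<in> Poly_Mapping.keys (basis_bracket L' k' T j)
        \<Longrightarrow> (L', k') = (L, k)"
      using witness[of L k] p z_index unfolding isolating_def by blast
    then have "s \<in> Poly_Mapping.keys (bracket z (basis_elem T j))"
      using p(1) z_index unfolding p_eq by (intro in_keys_bracket_basis_elem) blast+
    moreover have "bracket z (basis_elem T j) \<in> supported_on P"
      using z Tj by (simp add: idealizer_def)
    ultimately show False using s by (auto simp: supported_on_def)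
  qed
next
  fix z assume z: "z \<in> supported_on Q"
  have "bracket z h \<in> supported_on P" if h: "h \<in> supported_on P" for h
    unfolding supported_on_def
  proof (intro CollectI subsetI)
    fix s assume "s \<in> Poly_Mapping.keys (bracket z h)"
    then show "s \<in> P"
      using z h closed unfolding supported_on_def mem_Collect_eq
      by (elim in_keys_bracket) (meson subsetD)
  qed
  then show "z \<in> idealizer n (supported_on P)"
    using z assms(1) by (auto simp: idealizer_def lie_ring_eq supported_on_def)
qed

text \<open>A part of \<open>L\<close> is below \<open>k\<close> and a part of \<open>T\<close> is
  below \<open>j\<close>, so the order of \<open>j\<close> and \<open>k\<close> decides which half
  of the bracket can occur. The two cases are mirror images, so one weight estimate serves
  both.\<close>

lemma in_keys_basis_bracket_index_set [consumes 3, case_names left right]: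
  assumes L: "(L, k) \<in> index_set n" and T: "(T, j) \<in> index_set n"
    and S: "(S, l) \<in> Poly_Mapping.keys (basis_bracket L k T j)"
  obtains
    (left) "mult_of L j \<noteq> 0" "j < k" "l = k" "S = L - part j + T" "wt S + j = wt L + wt T"
      "num_parts S + 1 = num_parts L + num_parts T" "(S, l) \<in> index_set n"
  | (right) "mult_of T k \<noteq> 0" "k < j" "l = j" "S = T - part k + L" "wt S + k = wt T + wt L"
      "num_parts S + 1 = num_parts T + num_parts L" "(S, l) \<in> index_set n"
proof -
  have sq: "sqfree L" "sqfree T" and parts: "L \<in> parts2 (k - 1)" "T \<in> parts2 (j - 1)"
    and range: "1 \<le> k" "k \<le> n" "1 \<le> j" "j \<le> n"
    using L T by (auto simp: index_set_def parts2_iff)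
  have below: "j < k" if "mult_of L j \<noteq> 0"
    using that parts(1) range(1) unfolding parts2_iff by fastforce
  have below': "k < j" if "mult_of T k \<noteq> 0"
    using that parts(2) range(3) unfolding parts2_iff by fastforce
  from in_keys_basis_bracket[OF sq S] show thesis
  proof (elim disjE conjE)
    assume l: "mult_of L j \<noteq> 0" "sqfree S" "S = L - part j + T" "l = k"
    have "S \<in> parts2 (k - 1)"
      using l replace_part_in_parts2[OF parts(1,2)] below by simp
    then show thesis
      using l below wt_minus_part[OF l(1)] num_parts_minus_part[OF l(1)] range
      by (intro left) (simp_all add: index_set_def)
  next
    assume l: "mult_of T k \<noteq> 0" "sqfree S" "S = L + (T - part k)" "l = j"
    have "S \<in> parts2 (j - 1)"
      using l replace_part_in_parts2[OF parts(2,1)] below' by (simp add: add.commute)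
    then show thesis
      using l below' wt_minus_part[OF l(1)] num_parts_minus_part[OF l(1)] range
      by (intro right) (simp_all add: index_set_def add.commute)
  qed
qed

text \<open>If \<open>T\<close> has at most one part, then \<open>wt T < j\<close> and the level of
  \<open>L\<close> drops. If \<open>L\<close> is the part \<open>j\<close> alone, then
  \<open>S\<close> has the weight of \<open>T\<close> while the index rises from \<open>j\<close> to
  \<open>k\<close>, so the level of \<open>T\<close> drops. Otherwise the two weight bounds add up,
  and the last condition on \<open>a\<close>, \<open>b\<close>, \<open>c\<close> applies.\<close>

lemma bracket_weight_bound:
  assumes L: "(L, k) \<in> index_set n" "num_parts L \<le> 1 \<or> wt L + n \<le> a + 2 + k"
    and T: "(T, j) \<in> index_set n" "num_parts T \<le> 1 \<or> wt T + n \<le> b + 2 + j"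
    and j: "mult_of L j \<noteq> 0" "j < k"
    and S: "wt S + j = wt L + wt T" "num_parts S + 1 = num_parts L + num_parts T"
    and abc: "a \<le> c + 1" "b \<le> c + 1" "a + b + 2 \<le> c + n"
  shows "num_parts S \<le> 1 \<or> wt S + n \<le> c + 2 + k"
proof (cases "num_parts T \<le> 1")
  case True
  have "1 \<le> j" using T by (simp add: index_set_def)
  moreover have "wt T \<le> j - 1"
    using wt_le_of_num_parts_le_1[OF True] T(1) by (simp add: index_set_def)
  ultimately show ?thesis using True L(2) S abc by linarith
next
  case T2: False
  then have wt_T: "wt T + n \<le> b + 2 + j" using T(2) by simp
  have "num_parts L \<noteq> 0" using j by auto
  then consider "num_parts L = 1" | "2 \<le> num_parts L" by linarith
  then show ?thesis
  proof cases
    case 1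
    then have "wt L = j" using wt_single_part(2) j(1) by blast
    then show ?thesis using wt_T S j(2) abc by linarith
  next
    case 2
    then have "wt L + n \<le> a + 2 + k" using L(2) by simp
    then show ?thesis using wt_T S abc by linarith
  qed
qed

text \<open>The weight estimate is used with \<open>c = i - 1\<close> and with \<open>i\<close> and
  \<open>i - 1\<close> as the two bounds, in either order. Its last condition then reads
  \<open>i + 2 \<le> n\<close>.\<close>

lemma layer_bracket:
  assumes i: "1 \<le> i" "i + 2 \<le> n"
    and L: "(L, k) \<in> layer n i" and T: "(T, j) \<in> layer n (i - 1)"
    and S: "s \<in> Poly_Mapping.keys (basis_bracket L k T j)"
  shows "s \<in> layer n (i - 1)"
proof -
  obtain S l where s: "s = (S, l)" by (cases s)
  have idx: "(L, k) \<in> index_set n" "(T, j) \<in> index_set n"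
    and bounds: "num_parts L \<le> 1 \<or> wt L + n \<le> i + 2 + k" "num_parts T \<le> 1 \<or> wt T + n \<le> i - 1 + 2 + j"
    using L T by (auto simp: layer_def)
  from idx S[unfolded s] show ?thesis unfolding s
  proof (cases rule: in_keys_basis_bracket_index_set)
    case left
    have "num_parts S \<le> 1 \<or> wt S + n \<le> i - 1 + 2 + k"
      by (rule bracket_weight_bound[OF idx(1) bounds(1) idx(2) bounds(2)]) (use left i in simp_all)
    then show "(S, l) \<in> layer n (i - 1)" using left by (simp add: layer_def)
  next
    case right
    have "num_parts S \<le> 1 \<or> wt S + n \<le> i - 1 + 2 + j"
      by (rule bracket_weight_bound[OF idx(2) bounds(2) idx(1) bounds(1)]) (use right i in simp_all)
    then show "(S, l) \<in> layer n (i - 1)" using right by (simp add: layer_def)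
  qed
qed

text \<open>Since \<open>j < k\<close>, a term at index \<open>k\<close> can only come from the left
  half. There \<open>L\<close> is recovered by cancelling \<open>T\<close> and putting the part
  \<open>j\<close> back.\<close>

lemma isolating_left:
  assumes L: "(L, k) \<in> index_set n" and T: "(T, j) \<in> index_set n"
    and j: "mult_of L j \<noteq> 0" and sq: "sqfree (L - part j + T)"
  shows "isolating n L k T j (L - part j + T, k)"
  unfolding isolating_def
proof (intro conjI allI impI)
  have LT: "sqfree L" "sqfree T" using L T by (auto simp: index_set_def parts2_iff)
  have "j < k" using index_set_part[OF L j] by simp
  let ?B = "if mult_of T k \<noteq> 0 \<and> sqfree (L + (T - part k)) then basis_elem (L + (T - part k)) j else 0"
  have "basis_bracket L k T j = basis_elem (L - part j + T) k - ?B"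
    using j sq by (simp only: basis_bracket_eq[OF LT] simp_thms if_True)
  moreover have "Poly_Mapping.lookup ?B (L - part j + T, k) = 0"
    using \<open>j < k\<close> by (simp add: basis_elem_def lookup_single)
  ultimately show "(L - part j + T, k) \<in> Poly_Mapping.keys (basis_bracket L k T j)"
    by (simp add: in_keys_iff lookup_minus basis_elem_def)
  fix L' k'
  assume "(L', k') \<in> index_set n" "(L - part j + T, k) \<in> Poly_Mapping.keys (basis_bracket L' k' T j)"
  from this(1) T this(2) show "(L', k') = (L, k)"
  proof (cases rule: in_keys_basis_bracket_index_set)
    case left
    then have "L' - part j = L - part j" by (metis add_right_cancel)
    then have "L' = L" using minus_part_add left(1) j by metis
    then show ?thesis using left(3) by simp
  qed (use \<open>j < k\<close> in simp)
qed

text \<open>Bracketing with \<open>part k\<close> at index \<open>k + 1\<close> moves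
  \<open>L\<close> from index \<open>k\<close> to \<open>k + 1\<close> unchanged. The left half
  would need \<open>k + 1 < k + 1\<close>, and in the right half the only part of
  \<open>part k\<close> forces \<open>k' = k\<close>.\<close>

lemma isolating_right:
  assumes L: "(L, k) \<in> index_set n" and k: "k < n"
  shows "isolating n L k (part k) (k + 1) (L, k + 1)"
  unfolding isolating_def
proof (intro conjI allI impI)
  have T: "(part k, k + 1) \<in> index_set n" using L k by (simp add: index_set_def)
  have LT: "sqfree L" "sqfree (part k)" using L T by (auto simp: index_set_def parts2_iff)
  have "mult_of L (k + 1) = 0"
    using index_set_part(2)[OF L, of "k + 1"] by linarith
  then have "basis_bracket L k (part k) (k + 1) = - basis_elem L (k + 1)"
    using LT by (simp add: basis_bracket_eq lookup_part)
  then show "(L, k + 1) \<in> Poly_Mapping.keys (basis_bracket L k (part k) (k + 1))"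
    by (simp add: in_keys_iff basis_elem_def)
  fix L' k'
  assume "(L', k') \<in> index_set n" "(L, k + 1) \<in> Poly_Mapping.keys (basis_bracket L' k' (part k) (k + 1))"
  from this(1) T this(2) show "(L', k') = (L, k)"
  proof (cases rule: in_keys_basis_bracket_index_set)
    case right
    have "k' = k" using right(1) by (metis lookup_part)
    then show ?thesis using right(4) by simp
  qed simp
qed

text \<open>As \<open>k \<le> n\<close>, the weight condition gives \<open>wt L \<le> 2\<close>,
  which is impossible with two or more parts.\<close>

lemma layer_0: "layer n 0 = {(L, k) \<in> index_set n. num_parts L \<le> 1}"
proof -
  have "num_parts L \<le> 1" if "(L, k) \<in> index_set n" "wt L + n \<le> 2 + k" for L k
    using that wt_ge_3[of L "k - 1"] by (fastforce simp: index_set_def)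
  then show ?thesis by (auto simp: layer_def)
qed

text \<open>A derivation removes one part, so at most one part becomes none. With two or more parts,
  the derivation at any part of \<open>L\<close> leaves a nonempty partition.\<close>

lemma idealizer_chain_0: "idealizer_chain n 0 = supported_on (layer n 0)"
  unfolding idealizer_chain.simps derivations_span_eq
proof (rule idealizer_supported_on_eqI)
  show "layer n 0 \<subseteq> index_set n" by (auto simp: layer_def)
next
  fix L k T j s
  assume Lk: "(L, k) \<in> layer n 0" and Tj: "(T, j) \<in> {(0, k) |k. k \<in> {1..n}}"
    and s: "s \<in> Poly_Mapping.keys (basis_bracket L k T j)"
  have L: "(L, k) \<in> index_set n" "num_parts L \<le> 1" and T: "T = 0" "(T, j) \<in> index_set n"
    using Lk Tj by (auto simp: layer_0 index_set_def)
  obtain S l where [simp]: "s = (S, l)" by (cases s)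
  from L(1) T(2) s[simplified] show "s \<in> {(0, k) |k. k \<in> {1..n}}"
  proof (cases rule: in_keys_basis_bracket_index_set)
    case left
    have "num_parts S = 0" using left(6) L(2) num_parts_zero unfolding T(1) by linarith
    then show ?thesis using left(7) by (simp add: index_set_def)
  qed (simp add: T(1))
next
  fix L k
  assume "(L, k) \<in> index_set n - layer n 0"
  then have L: "(L, k) \<in> index_set n" "2 \<le> num_parts L" by (auto simp: layer_0)
  then obtain j where j: "mult_of L j \<noteq> 0" using exists_part[of L] by force
  then have j_range: "1 \<le> j" "j < k" "k \<le> n" "sqfree L"
    using index_set_part[OF L(1) j] L(1) by (auto simp: index_set_def parts2_iff)
  \<comment> \<open>The summand 0 stands for \<open>T = 0\<close>, to match the form of
    \<open>isolating_left\<close>.\<close>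
  have "sqfree (L - part j + 0)"
    using \<open>sqfree L\<close> by (auto simp: sqfree_def lookup_minus intro: le_trans[OF diff_le_self])
  then have "isolating n L k 0 j (L - part j + 0, k)"
    using L j j_range by (intro isolating_left) (simp_all add: index_set_def)
  moreover have "num_parts (L - part j) \<noteq> 0"
    using num_parts_minus_part[OF j] L(2) by linarith
  ultimately show "\<exists>T j s. (T, j) \<in> {(0, k) |k. k \<in> {1..n}} \<and> s \<notin> {(0, k) |k. k \<in> {1..n}} \<and>
      isolating n L k T j s"
    using j_range by (intro exI[of _ 0] exI[of _ j] exI[of _ "(L - part j + 0, k)"]) auto
qed

lemma layer_witness:
  assumes i: "1 \<le> i" and Lk: "(L, k) \<in> index_set n - layer n i"
  shows "\<exists>T j s. (T, j) \<in> layer n (i - 1) \<and> s \<notin> layer n (i - 1) \<and> isolating n L k T j s"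
proof -
  have L: "(L, k) \<in> index_set n" and num: "2 \<le> num_parts L" and wt: "i + 2 + k < wt L + n"
    using Lk by (auto simp: layer_def)
  have sq: "sqfree L" and k: "1 \<le> k" "k \<le> n"
    using L by (auto simp: index_set_def parts2_iff)
  \<comment> \<open>Either some part \<open>t + 1\<close> can be lowered to the missing value
    \<open>t\<close>, or the parts form an initial segment.\<close>
  consider (gap) t where "1 \<le> t" "mult_of L (t + 1) \<noteq> 0" "mult_of L t = 0"
    | (no_gap) "\<And>t. 1 \<le> t \<Longrightarrow> mult_of L (t + 1) \<noteq> 0 \<Longrightarrow> mult_of L t \<noteq> 0"
    by blast
  then show ?thesis
  proof cases
    case gap
    have T: "(part t, t + 1) \<in> layer n (i - 1)"
      using gap(1) index_set_part[OF L gap(2)] k by (simp add: layer_def index_set_def)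
    have "sqfree (L - part (t + 1) + part t)"
      using sq gap by (auto simp: sqfree_def lookup_add lookup_minus lookup_part intro: le_trans[OF diff_le_self])
    then have "isolating n L k (part t) (t + 1) (L - part (t + 1) + part t, k)"
      using L T gap(2) by (intro isolating_left) (auto simp: layer_def)
    \<comment> \<open>The number of parts is kept and the weight drops by exactly 1, so the level is
      still above \<open>i - 1\<close>.\<close>
    moreover have "(L - part (t + 1) + part t, k) \<notin> layer n (i - 1)"
      using num wt i num_parts_minus_part[OF gap(2)] wt_minus_part[OF gap(2)] by (simp add: layer_def)
    ultimately show ?thesis using T by blast
  next
    case no_gap
    have below: "mult_of L m \<noteq> 0 \<Longrightarrow> 1 \<le> t \<Longrightarrow> t \<le> m \<Longrightarrow> mult_of L t \<noteq> 0" for m t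
    proof (induction m)
      case (Suc m)
      then show ?case using no_gap[of m] by (cases "t = Suc m") auto
    qed simp
    obtain m where m: "2 \<le> m" "mult_of L m \<noteq> 0"
      using exists_part_ge_2[of L "k - 1"] L num by (auto simp: index_set_def)
    have L12: "mult_of L 1 \<noteq> 0" "mult_of L 2 \<noteq> 0"
      using below[OF m(2), of 1] below[OF m(2), of 2] m(1) by simp_all
    show ?thesis
    proof (cases "num_parts L = 2")
      \<comment> \<open>At least three parts: removing the part 1 costs weight 1 and leaves two
        parts or more.\<close>
      case False
      have "sqfree (L - part 1 + 0)"
        using sq by (auto simp: sqfree_def lookup_minus intro: le_trans[OF diff_le_self])
      moreover have T: "(0, 1) \<in> layer n (i - 1)" using k by (simp add: layer_def index_set_def num_parts_def)
      ultimately have "isolating n L k 0 1 (L - part 1 + 0, k)"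
        using L L12(1) by (intro isolating_left) (auto simp: layer_def)
      moreover have "(L - part 1 + 0, k) \<notin> layer n (i - 1)"
        using num False wt i num_parts_minus_part[OF L12(1)] wt_minus_part[OF L12(1)]
        by (simp add: layer_def)
      ultimately show ?thesis using T by blast
    next
      case True
      have "mult_of (L - part 1) 2 \<noteq> 0"
        using L12(2) by (simp add: lookup_minus lookup_part)
      then have "wt (L - part 1) = 2"
        using True num_parts_minus_part[OF L12(1)] by (intro wt_single_part(2)) simp_all
      then have "wt L = 3" using wt_minus_part[OF L12(1)] by simp
      \<comment> \<open>With weight 3 the level is \<open>n - k + 1\<close>. It exceeds
        \<open>i \<ge> 1\<close>, which leaves room for the index \<open>k + 1\<close>.\<close>
      then have "k < n" using wt i by simp
      then have "isolating n L k (part k) (k + 1) (L, k + 1)" using L by (rule isolating_right[rotated])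
      moreover have "(part k, k + 1) \<in> layer n (i - 1)"
        using k \<open>k < n\<close> by (simp add: layer_def index_set_def)
      moreover have "(L, k + 1) \<notin> layer n (i - 1)"
        using wt num i by (simp add: layer_def)
      ultimately show ?thesis by blast
    qed
  qed
qed

text \<open>The start of the chain is known for every \<open>n\<close>; the bound
  \<open>i + 2 \<le> n\<close> enters the induction step through
  \<open>layer_bracket\<close>.\<close>

lemma idealizer_chain_eq: "i + 2 \<le> n \<or> i = 0 \<Longrightarrow> idealizer_chain n i = supported_on (layer n i)"
proof (induction i)
  case 0
  show ?case by (rule idealizer_chain_0)
next
  case (Suc i)
  have "idealizer n (supported_on (layer n i)) = supported_on (layer n (Suc i))"
  proof (rule idealizer_supported_on_eqI)
    show "layer n (Suc i) \<subseteq> index_set n" by (auto simp: layer_def)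
  next
    fix L k T j s
    assume "(L, k) \<in> layer n (Suc i)" "(T, j) \<in> layer n i" "s \<in> Poly_Mapping.keys (basis_bracket L k T j)"
    then show "s \<in> layer n i" using layer_bracket[of "Suc i" n] Suc.prems by simp
  next
    fix L k
    assume "(L, k) \<in> index_set n - layer n (Suc i)"
    then show "\<exists>T j s. (T, j) \<in> layer n i \<and> s \<notin> layer n i \<and> isolating n L k T j s"
      using layer_witness[of "Suc i" L k n] by simp
  qed
  then show ?case using Suc by simp
qed


section \<open>Counting\<close>

definition partitions2 :: "nat \<Rightarrow> multiplicities set" where
  "partitions2 w = {L. is_partition L \<and> sqfree L \<and> 2 \<le> num_parts L \<and> wt L = w}"

lemma p2_eq: "p2 w = card (partitions2 w)"
  by (simp add: p2_def partitions2_def sqfree_def)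

lemma partitions2_subset: "partitions2 w \<subseteq> parts2 (w - 1)"
proof
  fix L assume "L \<in> partitions2 w"
  then have L: "is_partition L" "sqfree L" "2 \<le> num_parts L" "wt L = w"
    by (auto simp: partitions2_def)
  have "1 \<le> j \<and> j \<le> w - 1" if "mult_of L j \<noteq> 0" for j
  proof -
    have "j \<noteq> 0" using L(1) that by (metis is_partition_def)
    then show ?thesis using part_less_wt[OF L(1,3) that] L(4) by simp
  qed
  then show "L \<in> parts2 (w - 1)" using L(2) by (simp add: parts2_iff)
qed

lemma finite_partitions2: "finite (partitions2 w)"
  using finite_subset[OF partitions2_subset finite_parts2] .

lemma p2_eq_0:
  assumes "w < 3"
  shows "p2 w = 0"
proof -
  have "3 \<le> w" if "L \<in> partitions2 w" for L
    using wt_ge_3[of L "w - 1"] partitions2_subset that by (auto simp: partitions2_def)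
  then have "partitions2 w = {}" using assms by (meson all_not_in_conv not_le)
  then show ?thesis by (simp add: p2_eq)
qed

text \<open>With at least two parts every part is below the weight \<open>w \<le> k\<close>, so the
  bound \<open>k - 1\<close> on the parts follows from the weight.\<close>

lemma partitions2_parts2:
  assumes "w \<le> k"
  shows "L \<in> partitions2 w \<longleftrightarrow> L \<in> parts2 (k - 1) \<and> 2 \<le> num_parts L \<and> wt L = w"
proof
  assume L: "L \<in> partitions2 w"
  then have "L \<in> parts2 (w - 1)" using partitions2_subset by blast
  moreover have "i \<le> w - 1 \<Longrightarrow> i \<le> k - 1" for i using assms by linarith
  ultimately have "L \<in> parts2 (k - 1)" by (simp add: parts2_iff)
  then show "L \<in> parts2 (k - 1) \<and> 2 \<le> num_parts L \<and> wt L = w"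
    using L by (simp add: partitions2_def)
qed (auto simp: partitions2_def parts2_def sqfree_def)

lemma card_W_inter_basis_at:
  assumes "1 \<le> i" "i + 2 \<le> n" "n - i + 1 \<le> k" "k \<le> n"
  shows "card (W n i \<inter> basis_at k) = p2 (k + 2 + i - n)"
proof -
  define w where "w = k + 2 + i - n"
  \<comment> \<open>The first claim uses \<open>i + 2 \<le> n\<close>; the second uses
    \<open>n < k + i\<close>, so that no subtraction is truncated.\<close>
  have w: "w \<le> k" "k + i - n + 2 = w" using assms by (simp_all add: w_def)
  have "basis_elem L k \<in> W n i \<longleftrightarrow> L \<in> partitions2 w" for L
    using assms unfolding W_def in_lie_basis_iff partitions2_parts2[OF w(1)]
    by (auto simp: index_set_def w(2) simp del: add_2_eq_Suc')
  then have "W n i \<inter> basis_at k = (\<lambda>L. basis_elem L k) ` partitions2 w"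
    using partitions2_parts2[OF w(1)] unfolding basis_at_def by blast
  moreover have "inj_on (\<lambda>L. basis_elem L k) X" for X by (simp add: inj_on_def)
  ultimately show ?thesis by (simp only: card_image p2_eq w_def)
qed

section \<open>Counting the monomials of a fixed level\<close>

lemma layer_mono: "i \<le> j \<Longrightarrow> layer n i \<subseteq> layer n j"
  by (auto simp: layer_def)

lemma finite_layer: "finite (layer n i)"
proof (rule finite_subset)
  show "layer n i \<subseteq> (\<Union>k\<in>{1..n}. (\<lambda>L. (L, k)) ` parts2 (k - 1))"
    by (auto simp: layer_def index_set_def)
qed (simp add: finite_parts2)

lemma card_layer_diff:
  assumes i: "1 \<le> i" "i + 2 \<le> n"
  shows "card (layer n i - layer n (i - 1)) = q2 (i + 2)"
proof -
  have "layer n i - layer n (i - 1)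
      = (\<lambda>(k, L). (L, k)) ` (SIGMA k:{n - i + 1..n}. partitions2 (k + 2 + i - n))"
    (is "?D = ?R")
  proof -
    have D: "(L, k) \<in> ?D \<longleftrightarrow> k \<in> {n - i + 1..n} \<and> L \<in> partitions2 (k + 2 + i - n)" for L k
    proof -
      have "(L, k) \<in> ?D \<longleftrightarrow> k \<in> {1..n} \<and> L \<in> parts2 (k - 1) \<and> 2 \<le> num_parts L \<and> wt L + n = i + 2 + k"
        using i by (auto simp: layer_def index_set_def)
      \<comment> \<open>As the weight is at least 3, the equation forces
        \<open>k \<ge> n - i + 1\<close>.\<close>
      also have "\<dots> \<longleftrightarrow> k \<in> {n - i + 1..n} \<and> L \<in> parts2 (k - 1) \<and> 2 \<le> num_parts L \<and> wt L + n = i + 2 + k"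
        using i wt_ge_3[of L "k - 1"] by auto
      also have "\<dots> \<longleftrightarrow> k \<in> {n - i + 1..n} \<and> L \<in> partitions2 (k + 2 + i - n)"
      proof (rule conj_cong[OF refl])
        assume "k \<in> {n - i + 1..n}"
        then have "k + 2 + i - n \<le> k" "wt L + n = i + 2 + k \<longleftrightarrow> wt L = k + 2 + i - n"
          using i by auto
        then show "L \<in> parts2 (k - 1) \<and> 2 \<le> num_parts L \<and> wt L + n = i + 2 + k \<longleftrightarrow>
            L \<in> partitions2 (k + 2 + i - n)"
          by (simp only: partitions2_parts2)
      qed
      finally show ?thesis .
    qed
    have R: "(L, k) \<in> ?R \<longleftrightarrow> k \<in> {n - i + 1..n} \<and> L \<in> partitions2 (k + 2 + i - n)" for L k
      by auto
    show ?thesis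
    proof (rule Set.set_eqI)
      fix p show "p \<in> ?D \<longleftrightarrow> p \<in> ?R" by (cases p) (simp only: D R)
    qed
  qed
  moreover have "inj_on (\<lambda>(k, L). (L, k)) X" for X :: "(nat \<times> multiplicities) set"
    by (auto simp: inj_on_def)
  ultimately have "card ?D = (\<Sum>k = n - i + 1..n. p2 (k + 2 + i - n))"
    by (simp add: card_image card_SigmaI finite_partitions2 p2_eq)
  \<comment> \<open>While \<open>k\<close> runs from \<open>n - i + 1\<close> to \<open>n\<close>,
    the weight runs from 3 to \<open>i + 2\<close>; the missing terms of \<open>q2\<close>, at 1 and
    2, vanish.\<close>
  also have "\<dots> = (\<Sum>w = 3..i + 2. p2 w)"
    using i by (intro sum.reindex_bij_witness[of _ "\<lambda>w. w + n - (i + 2)" "\<lambda>k. k + 2 + i - n"]) auto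
  also have "\<dots> = q2 (i + 2)"
    unfolding q2_def by (rule sum.mono_neutral_left) (auto simp: p2_eq_0)
  finally show ?thesis .
qed


section \<open>The quotients\<close>

lemma supported_on_add: "x \<in> supported_on P \<Longrightarrow> y \<in> supported_on P \<Longrightarrow> x + y \<in> supported_on P"
  using keys_add[of x y] by (auto simp: supported_on_def)

lemma supported_on_diff: "x \<in> supported_on P \<Longrightarrow> y \<in> supported_on P \<Longrightarrow> x - y \<in> supported_on P"
  using keys_diff[of x y] by (auto simp: supported_on_def)

lemma supported_on_scale: "x \<in> supported_on P \<Longrightarrow> lie_scale c x \<in> supported_on P"
  by (auto simp: supported_on_def in_keys_iff lookup_lie_scale)

lemma supported_on_zero [simp]: "0 \<in> supported_on P"
  by (simp add: supported_on_def)

definition coset_of :: "(multiplicities \<times> nat) set \<Rightarrow> lie \<Rightarrow> lie set" where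
  "coset_of A x = (\<lambda>v. v + x) ` supported_on A"

lemma mem_coset_of: "y \<in> coset_of A x \<longleftrightarrow> y - x \<in> supported_on A"
  by (auto simp: coset_of_def image_iff intro!: bexI[of _ "y - x"])

lemma coset_of_eq_iff: "coset_of A x = coset_of A y \<longleftrightarrow> x - y \<in> supported_on A"
proof
  assume "coset_of A x = coset_of A y"
  then show "x - y \<in> supported_on A" using mem_coset_of[of x A x] mem_coset_of[of x A y] by simp
next
  assume xy: "x - y \<in> supported_on A"
  have "z - x \<in> supported_on A \<longleftrightarrow> z - y \<in> supported_on A" for z
    using supported_on_add[OF _ xy, of "z - x"] supported_on_diff[OF _ xy, of "z - y"] by auto
  then show "coset_of A x = coset_of A y" by (auto simp: mem_coset_of)
qed

section \<open>The quotient of two coordinate subspaces\<close>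

abbreviation supported_quotient ::
  "(multiplicities \<times> nat) set \<Rightarrow> (multiplicities \<times> nat) set \<Rightarrow> (bit, lie set) module" where
  "supported_quotient A B \<equiv> quotient_module (lie_module (supported_on B)) (supported_on A)"

lemma carrier_supported_quotient:
  "carrier (supported_quotient A B) = coset_of A ` supported_on B"
  by (auto simp: quotient_module_def lie_module_def A_RCOSETS_def' a_r_coset_def' coset_of_def)

lemma zero_supported_quotient: "\<zero>\<^bsub>supported_quotient A B\<^esub> = coset_of A 0"
  by (simp add: quotient_module_def coset_of_def)

lemma add_supported_quotient:
  "coset_of A x \<oplus>\<^bsub>supported_quotient A B\<^esub> coset_of A y = coset_of A (x + y)"
proof -
  have "coset_of A x \<oplus>\<^bsub>supported_quotient A B\<^esub> coset_of A y
      = {a + b | a b. a \<in> coset_of A x \<and> b \<in> coset_of A y}"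
    by (auto simp: quotient_module_def lie_module_def set_add_def')
  also have "\<dots> = coset_of A (x + y)"
  proof (intro equalityI subsetI)
    fix z assume "z \<in> {a + b | a b. a \<in> coset_of A x \<and> b \<in> coset_of A y}"
    then obtain a b where z: "z = a + b" and ab: "a - x \<in> supported_on A" "b - y \<in> supported_on A"
      by (auto simp: mem_coset_of)
    have "z - (x + y) = (a - x) + (b - y)" by (simp add: z)
    then show "z \<in> coset_of A (x + y)"
      using supported_on_add[OF ab] by (simp only: mem_coset_of)
  next
    fix z assume "z \<in> coset_of A (x + y)"
    then have "z = (z - y) + y" "z - y \<in> coset_of A x" "y \<in> coset_of A y"
      by (simp_all add: mem_coset_of diff_diff_add add.commute)
    then show "z \<in> {a + b | a b. a \<in> coset_of A x \<and> b \<in> coset_of A y}" by blast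
  qed
  finally show ?thesis .
qed

text \<open>The scalar multiple is defined as a union over all representatives. They differ by
  elements supported on \<open>A\<close>, also after scaling, so all cosets in the union
  coincide.\<close>

lemma smult_supported_quotient:
  "c \<odot>\<^bsub>supported_quotient A B\<^esub> coset_of A x = coset_of A (lie_scale c x)"
proof -
  have "c \<odot>\<^bsub>supported_quotient A B\<^esub> coset_of A x = (\<Union>y\<in>coset_of A x. coset_of A (lie_scale c y))"
    by (auto simp: quotient_module_def lie_module_def a_r_coset_def' coset_of_def)
  also have "\<dots> = (\<Union>y\<in>coset_of A x. coset_of A (lie_scale c x))"
  proof (rule SUP_cong[OF refl])
    fix y assume "y \<in> coset_of A x"
    then have "lie_scale c y - lie_scale c x \<in> supported_on A"
      by (metis lie.scale_right_diff_distrib mem_coset_of supported_on_scale)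
    then show "coset_of A (lie_scale c y) = coset_of A (lie_scale c x)"
      by (simp only: coset_of_eq_iff)
  qed
  also have "\<dots> = coset_of A (lie_scale c x)"
    using mem_coset_of[of x A x] by auto
  finally show ?thesis .
qed

lemmas supported_quotient_simps =
  carrier_supported_quotient zero_supported_quotient add_supported_quotient smult_supported_quotient

lemma lie_double: "x + x = (0 :: lie)"
  by (rule poly_mapping_eqI) (simp add: lookup_add)

lemma vectorspace_supported_quotient: "vectorspace class_ring (supported_quotient A B)"
proof (rule vectorspace.intro)
  have "abelian_group (supported_quotient A B)"
  proof (rule abelian_groupI)
    fix X assume "X \<in> carrier (supported_quotient A B)"
    then obtain x where x: "x \<in> supported_on B" "X = coset_of A x"
      by (auto simp: carrier_supported_quotient)
    have "coset_of A (0 - x) \<in> carrier (supported_quotient A B)"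
      using supported_on_diff[OF supported_on_zero x(1)] by (auto simp: carrier_supported_quotient)
    moreover have "coset_of A (0 - x) \<oplus>\<^bsub>supported_quotient A B\<^esub> X = \<zero>\<^bsub>supported_quotient A B\<^esub>"
      by (simp add: x(2) supported_quotient_simps)
    ultimately show "\<exists>Y\<in>carrier (supported_quotient A B).
        Y \<oplus>\<^bsub>supported_quotient A B\<^esub> X = \<zero>\<^bsub>supported_quotient A B\<^esub>" by blast
  qed (auto simp: supported_quotient_simps add_ac intro: supported_on_add)
  then show "Module.module class_ring (supported_quotient A B)"
    by (intro Module.moduleI class_cring.is_cring)
      (auto simp: supported_quotient_simps supported_on_scale class_ring_simps
        lie.scale_left_distrib lie.scale_right_distrib lie_double)
  show "field (class_ring :: bit ring)" by (rule class_field)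
qed

text \<open>The cosets of the basis elements indexed by \<open>B - A\<close> form a basis: modulo
  elements supported on \<open>A\<close>, exactly the coordinates outside \<open>A\<close>
  matter.\<close>

lemma dim_supported_quotient:
  assumes "A \<subseteq> B" "finite B"
  shows "vectorspace.fin_dim class_ring (supported_quotient A B)"
    and "vectorspace.dim class_ring (supported_quotient A B) = card (B - A)"
proof -
  interpret Q: vectorspace class_ring "supported_quotient A B"
    by (rule vectorspace_supported_quotient)
  define g where "g p = coset_of A (basis_elem (fst p) (snd p))" for p
  let ?D = "B - A"
  have fin: "finite ?D" using assms(2) by simp
  have g_carrier: "g ` ?D \<subseteq> carrier (supported_quotient A B)"
    by (auto simp: g_def carrier_supported_quotient)
  have inj: "inj_on g ?D"
  proof (rule inj_onI)
    fix p q assume p: "p \<in> ?D" and q: "q \<in> ?D" and "g p = g q"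
    then have "basis_elem (fst p) (snd p) - basis_elem (fst q) (snd q) \<in> supported_on A"
      by (simp add: g_def coset_of_eq_iff)
    then have "Poly_Mapping.lookup (basis_elem (fst p) (snd p) - basis_elem (fst q) (snd q)) p = 0"
      using p by (auto simp: supported_on_def in_keys_iff)
    then show "p = q" by (auto simp: basis_elem_def lookup_minus lookup_single when_def split: if_splits)
  qed
  \<comment> \<open>A combination of cosets is the coset of the combination of representatives;
    injectivity of \<open>g\<close> lets the sum run over indices.\<close>
  have lincomb: "Q.lincomb a (g ` E)
      = coset_of A (\<Sum>p\<in>E. lie_scale (a (g p)) (basis_elem (fst p) (snd p)))"
    if "E \<subseteq> ?D" for a E
    using finite_subset[OF that fin] that
  proof (induction E rule: finite_induct)
    case empty
    show ?case by (simp add: zero_supported_quotient)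
  next
    case (insert p E)
    have "g p \<notin> g ` E" using insert inj by (auto simp: inj_on_def)
    then have "Q.lincomb a (g ` insert p E)
        = a (g p) \<odot>\<^bsub>supported_quotient A B\<^esub> g p \<oplus>\<^bsub>supported_quotient A B\<^esub> Q.lincomb a (g ` E)"
      unfolding image_insert using insert.hyps insert.prems g_carrier
      by (intro Q.lincomb_insert2) auto
    also have "\<dots> = coset_of A (\<Sum>p\<in>insert p E. lie_scale (a (g p)) (basis_elem (fst p) (snd p)))"
      using insert by (simp add: g_def[of p] smult_supported_quotient add_supported_quotient)
    finally show ?case .
  qed
  have lookup_comb: "Poly_Mapping.lookup (\<Sum>p\<in>?D. lie_scale (c p) (basis_elem (fst p) (snd p))) s
      = (if s \<in> ?D then c s else 0)" for c s
  proof -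
    have "Poly_Mapping.lookup (\<Sum>p\<in>?D. lie_scale (c p) (basis_elem (fst p) (snd p))) s
        = (\<Sum>p\<in>?D. if s = p then c p else 0)"
      unfolding lookup_sum
      by (rule sum.cong) (auto simp: lookup_lie_scale basis_elem_def lookup_single when_def)
    also have "\<dots> = (if s \<in> ?D then c s else 0)" by (rule sum.delta'[OF fin])
    finally show ?thesis .
  qed
  have gen: "Q.gen_set (g ` ?D)"
  proof
    show "Q.span (g ` ?D) \<subseteq> carrier (supported_quotient A B)"
      by (rule Q.span_is_subset2[OF g_carrier])
    show "carrier (supported_quotient A B) \<subseteq> Q.span (g ` ?D)"
    proof
      fix X assume "X \<in> carrier (supported_quotient A B)"
      then obtain x where x: "x \<in> supported_on B" "X = coset_of A x"
        by (auto simp: carrier_supported_quotient)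
      \<comment> \<open>Coefficients are functions on cosets, so the coordinate of \<open>x\<close>
        is read off at the index of the coset.\<close>
      define a where "a C = Poly_Mapping.lookup x (inv_into ?D g C)" for C
      let ?y = "\<Sum>p\<in>?D. lie_scale (a (g p)) (basis_elem (fst p) (snd p))"
      \<comment> \<open>On \<open>B - A\<close> the two coordinates agree, and outside
        \<open>B\<close> both are 0.\<close>
      have "Poly_Mapping.lookup (x - ?y) s = 0" if "s \<notin> A" for s
        using that x(1) inj
        by (cases "s \<in> B")
          (auto simp: lookup_minus lookup_comb a_def supported_on_def in_keys_iff)
      then have "x - ?y \<in> supported_on A"
        unfolding supported_on_def by (auto simp: in_keys_iff)
      then have "X = Q.lincomb a (g ` ?D)"
        unfolding x(2) lincomb[OF subset_refl] by (simp only: coset_of_eq_iff)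
      then show "X \<in> Q.span (g ` ?D)"
        using fin unfolding Q.span_def by (auto simp: class_ring_simps)
    qed
  qed
  have "Q.lin_indpt (g ` ?D)"
  proof (rule Q.finite_lin_indpt2)
    fix a assume "Q.lincomb a (g ` ?D) = \<zero>\<^bsub>supported_quotient A B\<^esub>"
    then have in_A: "(\<Sum>p\<in>?D. lie_scale (a (g p)) (basis_elem (fst p) (snd p))) \<in> supported_on A"
      unfolding lincomb[OF subset_refl] zero_supported_quotient by (simp add: coset_of_eq_iff)
    have "a (g p) = 0" if "p \<in> ?D" for p
    proof -
      have "p \<notin> Poly_Mapping.keys (\<Sum>p\<in>?D. lie_scale (a (g p)) (basis_elem (fst p) (snd p)))"
        using in_A that unfolding supported_on_def by blast
      then show ?thesis
        using that lookup_comb[of "\<lambda>p. a (g p)" p] by (simp only: in_keys_iff if_True not_not)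
    qed
    then show "\<forall>v\<in>g ` ?D. a v = \<zero>\<^bsub>class_ring\<^esub>" by auto
  qed (use fin g_carrier in auto)
  then have basis: "Q.basis (g ` ?D)"
    using gen g_carrier unfolding Q.basis_def by blast
  show "Q.fin_dim"
    unfolding Q.fin_dim_def using fin g_carrier gen by blast
  show "Q.dim = card (B - A)"
    using Q.dim_basis[OF finite_imageI[OF fin] basis] card_image[OF inj] by (rule trans)
qed

text \<open>The inclusion and \<open>fin_dim\<close> belong to the claim because they give the
  quotient and \<open>dim\<close> their usual meaning.\<close>

theorem theorem2p14:
  fixes n i :: nat
  assumes "n > 0" and "1 \<le> i" and "i \<le> n - 2"
  shows "(\<forall>k. n - i + 1 \<le> k \<and> k \<le> n \<longrightarrow> card (W n i \<inter> basis_at k) = p2 (k + 2 + i - n))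
    \<and> idealizer_chain n (i - 1) \<subseteq> idealizer_chain n i
    \<and> vectorspace (class_ring :: bit ring) (chain_quotient n i)
    \<and> vectorspace.fin_dim (class_ring :: bit ring) (chain_quotient n i)
    \<and> vectorspace.dim (class_ring :: bit ring) (chain_quotient n i) = q2 (i + 2)"
proof -
  \<comment> \<open>As \<open>i \<ge> 1\<close>, the difference \<open>n - 2\<close> is positive and
    hence not truncated.\<close>
  have i: "i + 2 \<le> n" using assms by linarith
  have chain: "idealizer_chain n i = supported_on (layer n i)"
    "idealizer_chain n (i - 1) = supported_on (layer n (i - 1))"
    using i by (auto intro!: idealizer_chain_eq)
  have mono: "layer n (i - 1) \<subseteq> layer n i" by (rule layer_mono) simp
  have "supported_on (layer n (i - 1)) \<subseteq> supported_on (layer n i)"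
    using mono by (auto simp: supported_on_def)
  then show ?thesis
    unfolding chain_quotient_def chain
    using card_W_inter_basis_at[OF assms(2) i] vectorspace_supported_quotient
      dim_supported_quotient[OF mono finite_layer]
    unfolding card_layer_diff[OF assms(2) i] by blast
qed

end
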